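(* For all integers $n,k>0$, $$(-1)^k \left( pod(n)+2 \sum_{j=1}^{k} (-1)^{j}\, pod\big(n-4j^2\big) - Q_0(n) \right) = \sum_{j=0}^{\left\lfloor n/4 \right\rfloor} Q_0(n-4j)\, \overline{M}_k(j).$$
   Context: A partition of $n$ is a nonincreasing sequence of positive integers (called parts) with sum $n$; the empty partition is the only partition of $0$. $pod(n)$ is the number of partitions of $n$ in which odd parts are distinct and even parts are unrestricted; $pod(0)=1$ and $pod(x)=0$ if $x$ is not a nonnegative integer. $Q_0(n)$ is the number of partitions of $n$ into distinct parts none of which is congruent to $0$ modulo $4$; $Q_0(0)=1$. An overpartition of $n$ is a nonincreasing sequence of positive integers with sum $n$ in which the first occurrence of each number may be overlined. $\overline{M}_k(n)$ is the number of overpartitions of $n$ in which the first part larger than $k$ (that is, the smallest part size exceeding $k$, which must exist) appears at least $k+1$ times, where overlined and non-overlined occurrences are counted together; in particular $\overline{M}_k(0)=0$. For example $\overline{M}_2(12)=16$. Equivalently, $$\sum_{n=0}^\infty \overline{M}_k(n)\, q^n = \frac{(-q;q)_k}{(q;q)_k} \sum_{j=k+1}^{\infty} \frac{2\,q^{j(k+1)}}{1-q^j}\cdot \frac{(-q^{j+1};q)_{\infty}}{(q^{j+1};q)_{\infty}},$$ where $(a;q)_m=\prod_{i=0}^{m-1}(1-aq^i)$ and $(a;q)_\infty=\prod_{i\geqslant 0}(1-aq^i)$. *)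

theory Defs
  imports Main
begin

definition partitions :: "nat \<Rightarrow> nat list set" where
  "partitions n = {xs. sorted_wrt (\<ge>) xs \<and> (\<forall>x\<in>set xs. 0 < x) \<and> sum_list xs = n}"

text \<open>The argument of \<open>pod\<close> is an integer so that the convention that \<open>pod\<close> vanishes at
  negative arguments is not obscured by truncated subtraction.\<close>

definition pod :: "int \<Rightarrow> nat" where
  "pod x = (if x < 0 then 0
     else card {xs \<in> partitions (nat x). \<forall>m. odd m \<longrightarrow> count_list xs m \<le> 1})"

definition Q0 :: "nat \<Rightarrow> nat" where
  "Q0 n = card {xs \<in> partitions n. distinct xs \<and> (\<forall>x\<in>set xs. x mod 4 \<noteq> 0)}"

text \<open>An overpartition is a partition \<open>xs\<close> together with the set \<open>S\<close> of those part sizes whose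
  first occurrence is overlined. Multiplicities in \<open>xs\<close> therefore count overlined and
  non-overlined occurrences together.\<close>

definition overpartitions :: "nat \<Rightarrow> (nat list \<times> nat set) set" where
  "overpartitions n = {(xs, S). xs \<in> partitions n \<and> S \<subseteq> set xs}"

text \<open>In \<open>Mbar\<close>, \<open>p\<close> is the smallest part size exceeding \<open>k\<close>.\<close>

definition Mbar :: "nat \<Rightarrow> nat \<Rightarrow> nat" where
  "Mbar k n = card {(xs, S) \<in> overpartitions n.
     \<exists>p\<in>set xs. k < p \<and> (\<forall>x\<in>set xs. k < x \<longrightarrow> p \<le> x) \<and> k + 1 \<le> count_list xs p}"

text \<open>All the sets counted above are finite, so no cardinality is zero by convention.\<close>

lemma length_le_sum_list:
  fixes xs :: "nat list"
  shows "\<forall>x\<in>set xs. 0 < x \<Longrightarrow> length xs \<le> sum_list xs"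
  by (induction xs) auto

lemma finite_partitions: "finite (partitions n)"
proof (rule finite_subset)
  show "partitions n \<subseteq> {xs. set xs \<subseteq> {..n} \<and> length xs \<le> n}"
    unfolding partitions_def using length_le_sum_list member_le_sum_list by fastforce
  show "finite {xs. set xs \<subseteq> {..n} \<and> length xs \<le> n}"
    by (rule finite_lists_length_le) simp
qed

lemma finite_overpartitions: "finite (overpartitions n)"
proof (rule finite_subset)
  show "overpartitions n \<subseteq> (SIGMA xs : partitions n. Pow (set xs))"
    unfolding overpartitions_def by auto
  show "finite (SIGMA xs : partitions n. Pow (set xs))"
    using finite_partitions by (intro finite_SigmaI) auto
qed

lemma partitions_0: "partitions 0 = {[]}"
proof -
  have "xs = []" if "\<forall>x\<in>set xs. 0 < x" "sum_list xs = 0" for xs :: "nat list"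
    using length_le_sum_list[OF that(1)] that(2) by simp
  then show ?thesis unfolding partitions_def by auto
qed

lemma pod_0: "pod 0 = 1"
proof -
  have "{xs \<in> partitions (nat 0). \<forall>m. odd m \<longrightarrow> count_list xs m \<le> 1} = {[]}"
    by (auto simp: partitions_0)
  then show ?thesis by (simp add: pod_def)
qed

lemma Q0_0: "Q0 0 = 1"
proof -
  have "{xs \<in> partitions 0. distinct xs \<and> (\<forall>x\<in>set xs. x mod 4 \<noteq> 0)} = {[]}"
    by (auto simp: partitions_0)
  then show ?thesis by (simp add: Q0_def)
qed

lemma Mbar_0: "Mbar k 0 = 0"
proof -
  have "{(xs, S) \<in> overpartitions 0.
     \<exists>p\<in>set xs. k < p \<and> (\<forall>x\<in>set xs. k < x \<longrightarrow> p \<le> x) \<and> k + 1 \<le> count_list xs p} = {}"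
    by (auto simp: overpartitions_def partitions_0)
  then show ?thesis unfolding Mbar_def by (simp only: card.empty)
qed

end

theory Submission
  imports Defs "HOL-Computational_Algebra.Formal_Power_Series"
begin

text \<open>
  Write $q$ for the indeterminate. Two facts about generating functions combine to the theorem.

  The first is the truncated form of Gauss' theta identity,
  \[ \prod_{i \ge 1} \frac{1+q^i}{1-q^i} \Bigl(1 + 2 \sum_{j=1}^{k} (-1)^j q^{j^2}\Bigr)
     = 1 + (-1)^k \sum_n \overline{M}_k(n) q^n, \]
  where the product counts overpartitions. For $k = 0$ it sorts nonempty overpartitions by
  their smallest part. To pass from $k$ to $k+1$ one has to see that, with $s = k+1$, the series of
  $\overline{M}_k$ and of $\overline{M}_{k+1}$ add up to $2 q^{s^2}$ times the overpartition product.
  In the explicit series, sorted by the smallest part $p$ exceeding the bound, the summands of the two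
  series for one $p > s$ combine to a difference of consecutive values of
  $q^{ps} \prod_{i \ge p} (1+q^i)/(1-q^i)$, so the sum telescopes (\<open>over_tail_telescope\<close>,
  \<open>Mbar_gf_step\<close>, \<open>truncated_theta\<close>).

  The second is the product formula
  \[ \sum_n \mathit{pod}(n) q^n
     = \Bigl(\sum_n Q_0(n) q^n\Bigr) \prod_{i \ge 1} \frac{1+q^{4i}}{1-q^{4i}}, \]
  which follows by cancelling $(1-q^{2i})(1+q^{2i}) = 1-q^{4i}$ in the three products
  (\<open>pod_product\<close>). Putting $q^4$ for $q$ in the theta identity and multiplying by the series of
  $Q_0$ gives an identity of power series (\<open>pod_theta_eq\<close>) whose coefficients are the theorem.

  Infinite products are avoided: every product runs up to a bound $N$, and series are compared only
  in degrees up to $N$ (\<open>agree\<close>). The link with the counts is \<open>weighted_partitions_gf\<close>: if each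
  partition is weighted by a product of factors that depend on a part size and its multiplicity, then
  the generating function is a product with one factor for each part size.
\<close>

section \<open>Partitions weighted by their multiplicities\<close>

definition parts_upto :: "nat \<Rightarrow> nat \<Rightarrow> nat list set" where
  "parts_upto N n = {xs \<in> partitions n. set xs \<subseteq> {..N}}"

lemma finite_parts_upto: "finite (parts_upto N n)"
  unfolding parts_upto_def using finite_partitions by simp

lemma parts_upto_eq_partitions: "n \<le> N \<Longrightarrow> parts_upto N n = partitions n"
  unfolding parts_upto_def partitions_def using member_le_sum_list by fastforce

lemma sorted_eq_replicate_append_filter:
  fixes xs :: "nat list"
  assumes "sorted_wrt (\<ge>) xs" "set xs \<subseteq> {..a}"
  shows "replicate (count_list xs a) a @ filter (\<lambda>x. x \<noteq> a) xs = xs"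
  using assms
proof (induction xs)
  case (Cons x xs)
  show ?case
  proof (cases "x = a")
    case False
    then have "a \<notin> set (x # xs)" using Cons.prems by auto
    then have "count_list (x # xs) a = 0" "filter (\<lambda>x. x \<noteq> a) (x # xs) = x # xs"
      by (auto simp: count_list_0_iff intro: filter_True simp del: count_list.simps)
    then show ?thesis by simp
  qed (use Cons in auto)
qed simp

lemma count_list_replicate: "count_list (replicate m a) b = (if a = b then m else 0)"
  by (induction m) auto

text \<open>A partition with parts at most \<open>N + 1\<close> starts with its copies of \<open>N + 1\<close>; their number and the
  remaining partition, with parts at most \<open>N\<close>, are independent except for the total.\<close>

lemma sum_parts_upto_Suc:
  fixes g :: "nat list \<Rightarrow> 'a :: comm_monoid_add"
  shows "(\<Sum>xs\<in>parts_upto (Suc N) n. g xs)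
    = (\<Sum>m | m \<le> n \<and> Suc N * m \<le> n. \<Sum>xs\<in>parts_upto N (n - Suc N * m).
         g (replicate m (Suc N) @ xs))"
proof -
  let ?D = "SIGMA m : {m. m \<le> n \<and> Suc N * m \<le> n}. parts_upto N (n - Suc N * m)"
  have "(\<Sum>xs\<in>parts_upto (Suc N) n. g xs) = (\<Sum>(m, xs)\<in>?D. g (replicate m (Suc N) @ xs))"
  proof (rule sum.reindex_bij_witness[where
        i = "\<lambda>(m, xs). replicate m (Suc N) @ xs" and
        j = "\<lambda>xs. (count_list xs (Suc N), filter (\<lambda>x. x \<noteq> Suc N) xs)"], goal_cases)
    case (1 xs)
    then show ?case
      using sorted_eq_replicate_append_filter unfolding parts_upto_def partitions_def by auto
  next
    case (2 xs)
    let ?m = "count_list xs (Suc N)" and ?ys = "filter (\<lambda>x. x \<noteq> Suc N) xs"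
    have eq: "replicate ?m (Suc N) @ ?ys = xs"
      using 2 sorted_eq_replicate_append_filter unfolding parts_upto_def partitions_def by auto
    have "sum_list xs = n" using 2 unfolding parts_upto_def partitions_def by simp
    moreover have "sum_list xs = ?m * Suc N + sum_list ?ys"
      by (subst eq[symmetric]) (simp add: sum_list_replicate del: mult_Suc_right mult_Suc)
    ultimately have n: "n = Suc N * ?m + sum_list ?ys" by (simp only: mult.commute)
    then have "Suc N * ?m \<le> n" by linarith
    moreover then have "?m \<le> n" by simp
    moreover have "?ys \<in> parts_upto N (sum_list ?ys)"
      using 2 unfolding parts_upto_def partitions_def by (auto intro: sorted_wrt_filter simp: le_Suc_eq)
    moreover have "n - Suc N * ?m = sum_list ?ys" using n by linarith
    ultimately show ?case by simp
  next
    case (3 p)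
    then show ?case
      by (auto simp: parts_upto_def count_list_replicate count_list_0_iff intro!: filter_True)
  next
    case (4 p)
    have "sorted_wrt (\<ge>) (replicate m a)" for m and a :: nat by (induction m) auto
    with 4 show ?case
      by (auto simp: parts_upto_def partitions_def sorted_wrt_append sum_list_replicate
            algebra_simps subset_iff le_SucI)
  next
    case (5 xs)
    then show ?case
      using sorted_eq_replicate_append_filter unfolding parts_upto_def partitions_def by auto
  qed
  also have "\<dots> = (\<Sum>m | m \<le> n \<and> Suc N * m \<le> n. \<Sum>xs\<in>parts_upto N (n - Suc N * m).
         g (replicate m (Suc N) @ xs))"
    by (subst sum.Sigma) (auto intro: finite_subset[of _ "{..n}"] finite_parts_upto)
  finally show ?thesis .
qed

lemma fps_nth_compose_X_power:
  fixes f :: "'a :: comm_ring_1 fps"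
  assumes "i > 0"
  shows "fps_nth (f oo fps_X ^ i) n = (if i dvd n then fps_nth f (n div i) else 0)"
proof -
  have "fps_nth (f oo fps_X ^ i) n = (\<Sum>j=0..n. if n = i * j then fps_nth f j else 0)"
    by (simp add: fps_compose_nth flip: power_mult) (intro sum.cong, auto)
  also have "\<dots> = (\<Sum>j=0..n. if i dvd n \<and> j = n div i then fps_nth f j else 0)"
    using assms by (intro sum.cong) auto
  also have "\<dots> = (if i dvd n then fps_nth f (n div i) else 0)"
    by (cases "i dvd n") (auto simp: sum.delta)
  finally show ?thesis .
qed

lemma fps_nth_mult_compose_X_power:
  fixes f g :: "'a :: comm_ring_1 fps"
  assumes "i > 0"
  shows "fps_nth (g * (f oo fps_X ^ i)) n
    = (\<Sum>m | m \<le> n \<and> i * m \<le> n. fps_nth g (n - i * m) * fps_nth f m)"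
proof -
  have "fps_nth (g * (f oo fps_X ^ i)) n
    = (\<Sum>d=0..n. fps_nth g (n - d) * (if i dvd d then fps_nth f (d div i) else 0))"
    unfolding mult.commute[of g] fps_mult_nth
    by (simp add: fps_nth_compose_X_power[OF assms] mult.commute)
  also have "\<dots> = (\<Sum>d | d \<le> n \<and> i dvd d. fps_nth g (n - d) * fps_nth f (d div i))"
    by (rule sum.mono_neutral_cong_right) auto
  also have "\<dots> = (\<Sum>m | m \<le> n \<and> i * m \<le> n. fps_nth g (n - i * m) * fps_nth f m)"
    using assms by (intro sum.reindex_bij_witness[where i = "\<lambda>m. i * m" and j = "\<lambda>d. d div i"])
      (auto intro: order.trans[OF div_le_dividend])
  finally show ?thesis .
qed

text \<open>Substituting \<open>q ^ i\<close> into the series of the weights \<open>w i\<close> charges \<open>i\<close> for each copy of the part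
  \<open>i\<close>. The product arises one factor at a time, by splitting off the largest admissible part.\<close>

lemma weighted_partitions_gf:
  fixes w :: "nat \<Rightarrow> nat \<Rightarrow> 'a :: idom"
  shows "Abs_fps (\<lambda>n. \<Sum>xs\<in>parts_upto N n. \<Prod>i=1..N. w i (count_list xs i))
    = (\<Prod>i=1..N. Abs_fps (w i) oo fps_X ^ i)"
proof (induction N)
  case 0
  have "xs = []" if "set xs \<subseteq> {0}" "\<forall>x\<in>set xs. 0 < x" for xs :: "nat list"
    using that by (cases xs) auto
  then have "parts_upto 0 n = (if n = 0 then {[]} else {})" for n
    by (cases "n = 0") (fastforce simp: parts_upto_def partitions_def)+
  then show ?case by (auto simp: fps_eq_iff)
next
  case (Suc N)
  let ?F = "\<lambda>n. \<Sum>xs\<in>parts_upto N n. \<Prod>i=1..N. w i (count_list xs i)"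
  have "(\<Sum>xs\<in>parts_upto (Suc N) n. \<Prod>i=1..Suc N. w i (count_list xs i))
    = (\<Sum>m | m \<le> n \<and> Suc N * m \<le> n. ?F (n - Suc N * m) * w (Suc N) m)" for n
    unfolding sum_parts_upto_Suc sum_distrib_right
  proof (intro sum.cong refl)
    fix m xs assume "xs \<in> parts_upto N (n - Suc N * m)"
    then have "Suc N \<notin> set xs" by (auto simp: parts_upto_def)
    then show "(\<Prod>i=1..Suc N. w i (count_list (replicate m (Suc N) @ xs) i))
        = (\<Prod>i=1..N. w i (count_list xs i)) * w (Suc N) m"
      by (simp add: prod.nat_ivl_Suc' count_list_replicate)
  qed
  then have eq: "Abs_fps (\<lambda>n. \<Sum>xs\<in>parts_upto (Suc N) n. \<Prod>i=1..Suc N. w i (count_list xs i))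
    = Abs_fps ?F * (Abs_fps (w (Suc N)) oo fps_X ^ Suc N)"
    by (simp only: fps_eq_iff fps_nth_mult_compose_X_power[OF zero_less_Suc] fps_nth_Abs_fps) simp
  show ?case unfolding eq Suc.IH by (simp add: prod.nat_ivl_Suc' mult.commute del: power_Suc)
qed

text \<open>The parts of a partition of \<open>n\<close> lie between \<open>1\<close> and \<open>n\<close>, so a condition on all multiplicities is
  a condition on finitely many of them when it tolerates absent parts elsewhere.\<close>

lemma all_multiplicities_iff:
  assumes "n \<le> N" "\<And>i. i \<notin> {1..N} \<Longrightarrow> P i 0" "xs \<in> partitions n"
  shows "(\<forall>i. P i (count_list xs i)) \<longleftrightarrow> (\<forall>i\<in>{1..N}. P i (count_list xs i))"
proof -
  have "set xs \<subseteq> {1..N}"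
    using assms(1,3) member_le_sum_list unfolding partitions_def by fastforce
  then have "count_list xs i = 0" if "i \<notin> {1..N}" for i
    using that by (auto simp: count_list_0_iff)
  then show ?thesis using assms(2) by metis
qed

lemma card_partitions_gf:
  assumes "n \<le> N" "\<And>i. i \<notin> {1..N} \<Longrightarrow> P i 0"
  shows "int (card {xs \<in> partitions n. \<forall>i. P i (count_list xs i)})
    = fps_nth (\<Prod>i=1..N. Abs_fps (\<lambda>m. of_bool (P i m)) oo fps_X ^ i) n"
proof -
  have "int (card {xs \<in> partitions n. \<forall>i. P i (count_list xs i)})
    = (\<Sum>xs\<in>partitions n. of_bool (\<forall>i. P i (count_list xs i)))"
    using finite_partitions by (simp add: Int_def)
  also have "\<dots> = (\<Sum>xs\<in>partitions n. of_bool (\<forall>i\<in>{1..N}. P i (count_list xs i)))"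
    by (intro sum.cong refl arg_cong[where f = of_bool] all_multiplicities_iff[of n N P, OF assms])
  also have "\<dots> = (\<Sum>xs\<in>parts_upto N n. \<Prod>i=1..N. of_bool (P i (count_list xs i)))"
    unfolding parts_upto_eq_partitions[OF assms(1)] by (intro sum.cong refl) auto
  also have "\<dots> = fps_nth (\<Prod>i=1..N. Abs_fps (\<lambda>m. of_bool (P i m)) oo fps_X ^ i) n"
    by (simp only: weighted_partitions_gf[symmetric] fps_nth_Abs_fps)
  finally show ?thesis .
qed

text \<open>A part that occurs can be overlined or not, whatever its multiplicity: this is the weight \<open>2\<close>.\<close>

lemma card_overpartitions_gf:
  assumes "n \<le> N" "\<And>i. i \<notin> {1..N} \<Longrightarrow> P i 0"
  shows "int (card {(xs, S) \<in> overpartitions n. \<forall>i. P i (count_list xs i)})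
    = fps_nth (\<Prod>i=1..N. Abs_fps (\<lambda>m. if P i m then if m = 0 then 1 else 2 else 0)
        oo fps_X ^ i) n"
proof -
  let ?P = "\<lambda>xs. \<forall>i. P i (count_list xs i)"
  have "{(xs, S) \<in> overpartitions n. ?P xs} = (SIGMA xs : {xs \<in> partitions n. ?P xs}. Pow (set xs))"
    by (auto simp: overpartitions_def)
  then have "int (card {(xs, S) \<in> overpartitions n. ?P xs})
    = (\<Sum>xs | xs \<in> partitions n \<and> ?P xs. 2 ^ card (set xs))"
    using finite_partitions by (simp add: card_SigmaI card_Pow)
  also have "\<dots> = (\<Sum>xs\<in>partitions n. if ?P xs then 2 ^ card (set xs) else 0)"
    using finite_partitions by (intro sum.mono_neutral_cong_left) auto
  also have "\<dots> = (\<Sum>xs\<in>parts_upto N n. \<Prod>i=1..N.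
      if P i (count_list xs i) then if count_list xs i = 0 then 1 else 2 else 0)"
    unfolding parts_upto_eq_partitions[OF assms(1)]
  proof (intro sum.cong refl)
    fix xs assume xs: "xs \<in> partitions n"
    then have sub: "set xs \<subseteq> {1..N}"
      using assms(1) member_le_sum_list unfolding partitions_def by fastforce
    show "(if ?P xs then 2 ^ card (set xs) else 0) = (\<Prod>i=1..N.
      if P i (count_list xs i) then if count_list xs i = 0 then 1 else 2 else (0 :: int))"
    proof (cases "?P xs")
      case True
      then have "(\<Prod>i=1..N. if P i (count_list xs i) then if count_list xs i = 0 then 1 else 2
          else (0 :: int)) = (\<Prod>i=1..N. if i \<in> set xs then 2 else 1)"
        by (intro prod.cong) (auto simp: count_list_0_iff)
      also have "\<dots> = (\<Prod>i\<in>set xs. 2)"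
        using sub by (intro prod.mono_neutral_cong_right) auto
      finally show ?thesis using True by simp
    next
      case False
      then obtain i where "i \<in> {1..N}" "\<not> P i (count_list xs i)"
        using all_multiplicities_iff[of n N P, OF assms xs] by blast
      then have "(\<Prod>i=1..N. if P i (count_list xs i) then if count_list xs i = 0 then 1 else 2
          else (0 :: int)) = 0"
        by (intro prod_zero bexI[of _ i]) auto
      then show ?thesis using False by (simp only: if_False)
    qed
  qed
  also have "\<dots> = fps_nth (\<Prod>i=1..N. Abs_fps (\<lambda>m. if P i m then if m = 0 then 1 else 2 else 0)
        oo fps_X ^ i) n"
    by (simp only: weighted_partitions_gf[symmetric] fps_nth_Abs_fps)
  finally show ?thesis .
qed

section \<open>The factor of a single part size\<close>

text \<open>The series \<open>1 / (1 - q ^ i)\<close>, defined without division because the coefficients are integers.\<close>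

definition geo :: "nat \<Rightarrow> int fps" where
  "geo i = Abs_fps (\<lambda>_. 1) oo fps_X ^ i"

definition over :: "nat \<Rightarrow> int fps" where
  "over i = (1 + fps_X ^ i) * geo i"

lemma geo_inverse:
  assumes "i > 0"
  shows "(1 - fps_X ^ i) * geo i = 1"
proof -
  have X: "fps_nth (fps_X ^ i :: int fps) 0 = 0" using assms by simp
  have "(1 - fps_X) * Abs_fps (\<lambda>_. 1 :: int) = 1"
    by (simp add: fps_eq_iff left_diff_distrib)
  then have "((1 - fps_X) * Abs_fps (\<lambda>_. 1 :: int)) oo fps_X ^ i = 1" by simp
  then show ?thesis
    using X unfolding geo_def
    by (simp add: fps_compose_mult_distrib fps_compose_sub_distrib)
qed

lemma compose_X_power_X_power:
  assumes "i > 0" "c > 0"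
  shows "(f oo fps_X ^ i) oo fps_X ^ c = (f oo fps_X ^ (c * i) :: int fps)"
  using assms
  by (simp add: fps_compose_assoc[symmetric] flip: fps_compose_power power_mult)

lemma over_compose:
  assumes "i > 0" "c > 0"
  shows "over i oo fps_X ^ c = over (c * i)"
  using assms unfolding over_def geo_def
  by (simp add: fps_compose_mult_distrib fps_compose_add_distrib compose_X_power_X_power
      flip: fps_compose_power power_mult)

text \<open>The next three lemmas identify the weights that occur: overlining with free multiplicity,
  multiplicity at most one, and overlining with multiplicity more than \<open>k\<close>.\<close>

lemma over_eq_Abs_fps:
  assumes "i > 0"
  shows "Abs_fps (\<lambda>m. if m = 0 then 1 else 2) oo fps_X ^ i = over i"
proof -
  have "Abs_fps (\<lambda>m. if m = 0 then 1 else 2) = (1 + fps_X) * Abs_fps (\<lambda>_. 1 :: int)"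
    by (simp add: fps_eq_iff distrib_right)
  then show ?thesis
    using assms by (simp add: over_def geo_def fps_compose_mult_distrib fps_compose_add_distrib)
qed

lemma at_most_once_eq:
  assumes "i > 0"
  shows "Abs_fps (\<lambda>m. of_bool (m \<le> 1)) oo fps_X ^ i = (1 + fps_X ^ i :: int fps)"
proof -
  have "Abs_fps (\<lambda>m. of_bool (m \<le> 1)) = (1 + fps_X :: int fps)"
    by (auto simp: fps_eq_iff fps_X_def)
  then show ?thesis using assms by (simp add: fps_compose_add_distrib)
qed

lemma more_than_eq:
  assumes "i > 0"
  shows "Abs_fps (\<lambda>m. if k + 1 \<le> m then if m = 0 then 1 else 2 else 0) oo fps_X ^ i
    = 2 * fps_X ^ (i * (k + 1)) * geo i"
proof -
  have "Abs_fps (\<lambda>m. if k + 1 \<le> m then if m = 0 then 1 else 2 else 0)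
    = fps_const 2 * (fps_X ^ (k + 1) * Abs_fps (\<lambda>_. 1 :: int))"
    by (auto simp: fps_eq_iff fps_X_power_mult_nth simp del: power_Suc)
  then show ?thesis
    using assms
    by (simp add: geo_def fps_compose_mult_distrib numeral_fps_const power_add
        flip: fps_compose_power power_mult)
qed

section \<open>Agreement of power series in low degrees\<close>

definition agree :: "nat \<Rightarrow> int fps \<Rightarrow> int fps \<Rightarrow> bool" where
  "agree N f g \<longleftrightarrow> (\<forall>i\<le>N. fps_nth f i = fps_nth g i)"

lemma agree_refl: "agree N f f" and agree_sym: "agree N f g \<Longrightarrow> agree N g f"
  and agree_trans [trans]: "agree N f g \<Longrightarrow> agree N g h \<Longrightarrow> agree N f h"
  by (auto simp: agree_def)

lemma agree_add: "agree N f g \<Longrightarrow> agree N f' g' \<Longrightarrow> agree N (f + f') (g + g')"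
  by (simp add: agree_def)

lemma agree_diff: "agree N f g \<Longrightarrow> agree N f' g' \<Longrightarrow> agree N (f - f') (g - g')"
  by (simp add: agree_def)

lemma agree_mult: "agree N f g \<Longrightarrow> agree N f' g' \<Longrightarrow> agree N (f * f') (g * g')"
  unfolding agree_def fps_mult_nth by (auto intro!: sum.cong)

lemma agree_X_power: "N < a \<Longrightarrow> agree N (f - fps_X ^ a * g) f"
  by (simp add: agree_def fps_X_power_mult_nth)

lemma agree_compose_X_power:
  assumes "agree N f g" "c > 0"
  shows "agree (c * N) (f oo fps_X ^ c) (g oo fps_X ^ c)"
  using assms by (auto simp: agree_def fps_nth_compose_X_power div_le_mono dest: div_le_mono[of _ "c * N" c])

lemma agree_prod_1:
  assumes "\<And>i. i \<in> I \<Longrightarrow> agree N (f i) 1"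
  shows "agree N (\<Prod>i\<in>I. f i) 1"
  using assms
proof (induction I rule: infinite_finite_induct)
  case (insert x F)
  then show ?case using agree_mult[of N "f x" 1 "prod f F" 1] by simp
qed (auto simp: agree_refl)

section \<open>The truncated theta identity\<close>

definition over_tail :: "nat \<Rightarrow> nat \<Rightarrow> int fps" where
  "over_tail N j = (\<Prod>i\<in>{j<..N}. over i)"

text \<open>The summand for \<open>p\<close> collects the overpartitions in which \<open>p\<close> is the smallest part exceeding
  \<open>k\<close>: parts up to \<open>k\<close> are free, those between \<open>k\<close> and \<open>p\<close> are absent, \<open>p\<close> occurs at least
  \<open>k + 1\<close> times, and larger parts are free again.\<close>

definition Mbar_gf :: "nat \<Rightarrow> nat \<Rightarrow> int fps" where
  "Mbar_gf N k = (\<Prod>i=1..k. over i) *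
     (\<Sum>p\<in>{k<..N}. 2 * fps_X ^ (p * (k + 1)) * geo p * over_tail N p)"

definition theta_gf :: "nat \<Rightarrow> int fps" where
  "theta_gf k = 1 + 2 * (\<Sum>j=1..k. (- 1) ^ j * fps_X ^ (j\<^sup>2))"

lemma over_tail_less:
  assumes "j < N"
  shows "over_tail N j = over (Suc j) * over_tail N (Suc j)"
proof -
  have "{j<..N} = insert (Suc j) {Suc j<..N}" using assms by auto
  then show ?thesis by (simp add: over_tail_def)
qed

lemma over_tail_self: "over_tail N N = 1"
  by (simp add: over_tail_def)

lemma sum_greaterThanAtMost_shift: "(\<Sum>p\<in>{s<..N}. f p) = (\<Sum>j=s..<N. f (Suc j))"
proof -
  have "{s<..N} = {Suc s..<Suc N}" by auto
  then show ?thesis by (simp only: sum.shift_bounds_Suc_ivl)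
qed

text \<open>Let \<open>R p\<close> be the product over the part sizes above \<open>p\<close>. Since
  \<open>R (p - 1) = (1 + q ^ p) / (1 - q ^ p) * R p\<close>, the summand equals
  \<open>q ^ (p * s) * R (p - 1) - q ^ ((p + 1) * s) * R p\<close>, which telescopes. The last term of the
  right-hand side is the price of stopping at \<open>N\<close>.\<close>

lemma over_tail_telescope:
  assumes "s \<le> N"
  shows "(\<Sum>p\<in>{s<..N}. fps_X ^ (p * s) * geo p * over_tail N p
      * ((1 - fps_X ^ s) + (1 + fps_X ^ s) * fps_X ^ p))
    = fps_X ^ (Suc s * s) * over_tail N s - fps_X ^ (Suc N * s)"
proof -
  define T where "T p = fps_X ^ (Suc p * s) * over_tail N p" for p
  have "fps_X ^ (Suc j * s) * geo (Suc j) * over_tail N (Suc j)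
      * ((1 - fps_X ^ s) + (1 + fps_X ^ s) * fps_X ^ Suc j) = T j - T (Suc j)"
    if "j < N" for j
  proof -
    let ?q = "fps_X ^ Suc j :: int fps" and ?g = "geo (Suc j)" and ?R = "over_tail N (Suc j)"
      and ?s = "fps_X ^ s :: int fps"
    have "T j = fps_X ^ (Suc j * s) * ((1 + ?q) * ?g * ?R)"
      by (simp only: T_def over_tail_less[OF that] over_def)
    moreover have "T (Suc j) = fps_X ^ (Suc j * s) * (?s * (((1 - ?q) * ?g) * ?R))"
    proof -
      have "fps_X ^ (Suc (Suc j) * s) = ?s * (fps_X ^ (Suc j * s) :: int fps)"
        by (simp only: mult_Suc[of "Suc j"] power_add)
      then show ?thesis
        unfolding T_def geo_inverse[OF zero_less_Suc] by (simp only: mult_1 ac_simps)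
    qed
    ultimately have "T j - T (Suc j)
        = fps_X ^ (Suc j * s) * ((1 + ?q) * ?g * ?R - ?s * (((1 - ?q) * ?g) * ?R))"
      by (simp only: right_diff_distrib)
    also have "\<dots> = fps_X ^ (Suc j * s) * ?g * ?R * ((1 - ?s) + (1 + ?s) * ?q)"
      by (simp only: algebra_simps mult_1_left)
    finally show ?thesis by simp
  qed
  then have "(\<Sum>p\<in>{s<..N}. fps_X ^ (p * s) * geo p * over_tail N p
      * ((1 - fps_X ^ s) + (1 + fps_X ^ s) * fps_X ^ p)) = (\<Sum>j=s..<N. T j - T (Suc j))"
    unfolding sum_greaterThanAtMost_shift by simp
  also have "\<dots> = T s - T N"
    using sum_Suc_diff'[of s N "\<lambda>j. - T j"] assms by simp
  finally show ?thesis by (simp add: T_def over_tail_self)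
qed

text \<open>Every nonempty overpartition is counted when \<open>k = 0\<close>. Algebraically this is again a telescoping
  sum, because \<open>2 * q ^ p / (1 - q ^ p) = (1 + q ^ p) / (1 - q ^ p) - 1\<close>.\<close>

lemma Mbar_gf_0: "Mbar_gf N 0 = (\<Prod>i=1..N. over i) - 1"
proof -
  have "2 * fps_X ^ Suc j * geo (Suc j) * over_tail N (Suc j) = over_tail N j - over_tail N (Suc j)"
    if "j < N" for j
  proof -
    have "over (Suc j) - 1 = over (Suc j) - (1 - fps_X ^ Suc j) * geo (Suc j)"
      by (simp only: geo_inverse)
    also have "\<dots> = 2 * fps_X ^ Suc j * geo (Suc j)" unfolding over_def by algebra
    finally have "over (Suc j) - 1 = 2 * fps_X ^ Suc j * geo (Suc j)" .
    moreover have "over_tail N j - over_tail N (Suc j) = (over (Suc j) - 1) * over_tail N (Suc j)"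
      unfolding over_tail_less[OF that] by (simp only: left_diff_distrib mult_1)
    ultimately show ?thesis by simp
  qed
  then have "Mbar_gf N 0 = (\<Sum>j=0..<N. over_tail N j - over_tail N (Suc j))"
    unfolding Mbar_gf_def sum_greaterThanAtMost_shift by simp
  also have "\<dots> = over_tail N 0 - over_tail N N"
    using sum_Suc_diff'[of 0 N "\<lambda>j. - over_tail N j"] by simp
  finally show ?thesis
    by (simp add: over_tail_def atLeastSucAtMost_greaterThanAtMost)
qed

text \<open>Put \<open>s = k + 1\<close> and let \<open>R\<close> be the product over the part sizes above \<open>s\<close>. Take out the factors of the
  part sizes up to \<open>k\<close> and the common factor \<open>2 / (1 - q ^ s)\<close>. The summand \<open>p = s\<close>, which only the series
  for \<open>k\<close> has, leaves \<open>q ^ (s * s) * R\<close>; the summands with \<open>p > s\<close> leave the telescoping sum, that is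
  \<open>q ^ (s * s) * q ^ s * R\<close> up to an error in degree \<open>(N + 1) * s > N\<close>. The resulting factor \<open>1 + q ^ s\<close>
  completes the overpartition product.\<close>

lemma Mbar_gf_step:
  assumes "k < N"
  shows "agree N (Mbar_gf N k + Mbar_gf N (Suc k))
    (2 * fps_X ^ ((Suc k)\<^sup>2) * (\<Prod>i=1..N. over i))"
proof -
  define s where "s = Suc k"
  define A where "A = (\<Prod>i=1..k. over i)"
  define R where "R = over_tail N s"
  define x :: "int fps" where "x = fps_X ^ s"
  have s: "s \<le> N" "s > 0" "Suc k = s" "k + 1 = s" using assms by (auto simp: s_def)
  have ivl: "{k<..N} = insert s {s<..N}" using assms by (auto simp: s_def)
  have O: "(\<Prod>i=1..N. over i) = A * over s * R"
  proof -
    have "{1..N} = {1..k} \<union> insert s {s<..N}" using assms by (auto simp: s_def)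
    then show ?thesis
      by (simp only: A_def R_def over_tail_def, subst prod.union_disjoint) (auto simp: s_def mult.assoc)
  qed
  let ?S = "\<lambda>m. \<Sum>p\<in>{s<..N}. 2 * fps_X ^ (p * m) * geo p * over_tail N p"
  have k: "Mbar_gf N k = A * (2 * x ^ s * geo s * R + ?S s)"
    unfolding Mbar_gf_def ivl A_def R_def x_def s by (simp add: power_mult)
  have "(\<Prod>i=1..s. over i) = A * over s" unfolding s_def A_def by simp
  then have sk: "Mbar_gf N s = A * over s * ?S (Suc s)" unfolding Mbar_gf_def by simp
  \<comment> \<open>Writing \<open>1\<close> as \<open>(1 - x) * geo s\<close> in front of the first sum exposes the common factor \<open>geo s\<close>.\<close>
  have S: "?S s + (1 + x) * geo s * ?S (Suc s) = 2 * geo s * (x ^ Suc s * R - fps_X ^ (Suc N * s))"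
  proof -
    have "?S s + (1 + x) * geo s * ?S (Suc s) = ((1 - x) * geo s) * ?S s + (1 + x) * geo s * ?S (Suc s)"
      using geo_inverse[of s] s unfolding x_def by simp
    also have "\<dots> = 2 * geo s * (\<Sum>p\<in>{s<..N}. fps_X ^ (p * s) * geo p * over_tail N p
      * ((1 - x) + (1 + x) * fps_X ^ p))"
      unfolding sum_distrib_left sum.distrib[symmetric]
      by (intro sum.cong refl) (simp add: power_add algebra_simps)
    also have "\<dots> = 2 * geo s * (x ^ Suc s * R - fps_X ^ (Suc N * s))"
      unfolding x_def over_tail_telescope[OF s(1)] R_def
      by (simp only: power_mult[symmetric] mult.commute[of s])
    finally show ?thesis .
  qed
  have "Mbar_gf N k + Mbar_gf N s
    = A * (2 * x ^ s * geo s * R + (?S s + (1 + x) * geo s * ?S (Suc s)))"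
    unfolding k sk over_def x_def by (simp only: algebra_simps)
  also have "\<dots> = 2 * x ^ s * (A * ((1 + x) * geo s) * R) - fps_X ^ (Suc N * s) * (2 * A * geo s)"
    unfolding S by (simp add: algebra_simps)
  also have "\<dots> = 2 * fps_X ^ (s\<^sup>2) * (\<Prod>i=1..N. over i) - fps_X ^ (Suc N * s) * (2 * A * geo s)"
    unfolding O unfolding over_def x_def by (simp add: power2_eq_square flip: power_mult)
  finally have eq: "Mbar_gf N k + Mbar_gf N s
    = 2 * fps_X ^ (s\<^sup>2) * (\<Prod>i=1..N. over i) - fps_X ^ (Suc N * s) * (2 * A * geo s)" .
  have "N < Suc N * s" using s(2) by (cases s) auto
  then show ?thesis unfolding s(3) eq by (rule agree_X_power)
qed

lemma truncated_theta:
  assumes "k \<le> N"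
  shows "agree N ((\<Prod>i=1..N. over i) * theta_gf k) (1 + (- 1) ^ k * Mbar_gf N k)"
  using assms
proof (induction k)
  case 0
  then show ?case by (simp add: Mbar_gf_0 theta_gf_def agree_refl)
next
  case (Suc k)
  let ?O = "\<Prod>i=1..N. over i" and ?e = "(- 1) ^ k :: int fps"
  have "?O * theta_gf (Suc k) = ?O * theta_gf k - ?e * (2 * fps_X ^ ((Suc k)\<^sup>2) * ?O)"
  proof -
    have "(\<Sum>j=1..Suc k. (- 1) ^ j * fps_X ^ (j\<^sup>2) :: int fps)
        = (\<Sum>j=1..k. (- 1) ^ j * fps_X ^ (j\<^sup>2)) - ?e * fps_X ^ ((Suc k)\<^sup>2)"
      by (subst sum.nat_ivl_Suc') simp_all
    then have "theta_gf (Suc k) = theta_gf k - ?e * (2 * fps_X ^ ((Suc k)\<^sup>2))"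
      unfolding theta_gf_def by (simp only: right_diff_distrib ac_simps add_diff_eq)
    then show ?thesis by (simp only: right_diff_distrib ac_simps)
  qed
  also have "agree N \<dots> ((1 + ?e * Mbar_gf N k) - ?e * (Mbar_gf N k + Mbar_gf N (Suc k)))"
    using Suc by (intro agree_diff agree_mult agree_refl agree_sym[OF Mbar_gf_step]) auto
  also have "(1 + ?e * Mbar_gf N k) - ?e * (Mbar_gf N k + Mbar_gf N (Suc k))
    = 1 + (- 1) ^ Suc k * Mbar_gf N (Suc k)"
    by (simp add: algebra_simps)
  finally show ?case .
qed

section \<open>The three counts as coefficients of products\<close>

lemma distinct_iff_count_list_le_1: "distinct xs \<longleftrightarrow> (\<forall>m. count_list xs m \<le> 1)"
proof (induction xs)
  case (Cons x xs)
  have "count_list xs x = 0" if "\<forall>m. count_list (x # xs) m \<le> 1"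
    using that[rule_format, of x] by simp
  moreover have "count_list xs m \<le> count_list (x # xs) m" for m by simp
  moreover have "count_list (x # xs) m \<le> 1" if "count_list xs x = 0" "count_list xs m \<le> 1" for m
    using that by auto
  ultimately have "(\<forall>m. count_list (x # xs) m \<le> 1)
      \<longleftrightarrow> count_list xs x = 0 \<and> (\<forall>m. count_list xs m \<le> 1)"
    by (meson order.trans)
  then show ?case by (simp only: distinct.simps Cons.IH count_list_0_iff)
qed simp

lemma pod_agree:
  "agree N (Abs_fps (\<lambda>n. int (pod (int n))))
    (\<Prod>i=1..N. if odd i then 1 + fps_X ^ i else geo i)"
  unfolding agree_def
proof (intro allI impI)
  fix n assume "n \<le> N"
  then have "int (pod (int n))
      = fps_nth (\<Prod>i=1..N. Abs_fps (\<lambda>m. of_bool (odd i \<longrightarrow> m \<le> 1)) oo fps_X ^ i) n"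
    by (subst card_partitions_gf[symmetric]) (simp_all add: pod_def)
  also have "(\<Prod>i=1..N. Abs_fps (\<lambda>m. of_bool (odd i \<longrightarrow> m \<le> 1)) oo fps_X ^ i)
      = (\<Prod>i=1..N. if odd i then 1 + fps_X ^ i else geo i)"
    by (intro prod.cong refl) (simp add: at_most_once_eq[simplified] geo_def)
  finally show "fps_nth (Abs_fps (\<lambda>n. int (pod (int n)))) n = fps_nth \<dots> n" by simp
qed

lemma Q0_agree:
  "agree N (Abs_fps (\<lambda>n. int (Q0 n))) (\<Prod>i=1..N. if 4 dvd i then 1 else 1 + fps_X ^ i)"
  unfolding agree_def
proof (intro allI impI)
  fix n assume "n \<le> N"
  have "{xs \<in> partitions n. distinct xs \<and> (\<forall>x\<in>set xs. x mod 4 \<noteq> 0)}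
      = {xs \<in> partitions n. \<forall>i. count_list xs i \<le> (if 4 dvd i then 0 else 1)}"
    by (intro Collect_cong conj_cong refl)
      (auto simp: distinct_iff_count_list_le_1 count_list_0_iff dvd_eq_mod_eq_0)
  then have "int (Q0 n)
      = fps_nth (\<Prod>i=1..N. Abs_fps (\<lambda>m. of_bool (m \<le> (if 4 dvd i then 0 else 1))) oo fps_X ^ i) n"
    using \<open>n \<le> N\<close> by (subst card_partitions_gf[symmetric]) (simp_all add: Q0_def)
  also have "(\<Prod>i=1..N. Abs_fps (\<lambda>m. of_bool (m \<le> (if 4 dvd i then 0 else 1))) oo fps_X ^ i)
      = (\<Prod>i=1..N. if 4 dvd i then 1 else 1 + fps_X ^ i :: int fps)"
  proof (intro prod.cong refl)
    fix i assume "i \<in> {1..N}"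
    have "Abs_fps (\<lambda>m. of_bool (m \<le> 0)) = (1 :: int fps)" by (simp add: fps_eq_iff)
    then show "Abs_fps (\<lambda>m. of_bool (m \<le> (if 4 dvd i then 0 else 1))) oo fps_X ^ i
        = (if 4 dvd i then 1 else 1 + fps_X ^ i :: int fps)"
      using \<open>i \<in> {1..N}\<close> at_most_once_eq[of i] by simp
  qed
  finally show "fps_nth (Abs_fps (\<lambda>n. int (Q0 n))) n = fps_nth \<dots> n" by simp
qed

lemma Mbar_agree:
  assumes "k \<le> N"
  shows "agree N (Abs_fps (\<lambda>n. int (Mbar k n))) (Mbar_gf N k)"
  unfolding agree_def
proof (intro allI impI)
  fix n assume n: "n \<le> N"
  \<comment> \<open>\<open>P p i\<close> is what the multiplicity of \<open>i\<close> must satisfy if \<open>p\<close> is the smallest part exceeding \<open>k\<close> and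
    occurs often enough. As this \<open>p\<close> is unique, the sets \<open>A p\<close> split the counted overpartitions.\<close>
  define P where "P p i m \<longleftrightarrow> (k < i \<and> i < p \<longrightarrow> m = 0) \<and> (i = p \<longrightarrow> k + 1 \<le> m)" for p i m :: nat
  define A where "A p = {(xs, S) \<in> overpartitions n. \<forall>i. P p i (count_list xs i)}" for p
  have P_iff: "(\<forall>i. P p i (count_list xs i))
      \<longleftrightarrow> p \<in> set xs \<and> (\<forall>x\<in>set xs. k < x \<longrightarrow> p \<le> x) \<and> k + 1 \<le> count_list xs p" for p xs
  proof -
    have "count_list xs p \<noteq> 0 \<longleftrightarrow> p \<in> set xs" by (simp add: count_list_0_iff)
    moreover have "(\<forall>i. k < i \<and> i < p \<longrightarrow> count_list xs i = 0) \<longleftrightarrow> (\<forall>x\<in>set xs. k < x \<longrightarrow> p \<le> x)"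
      by (metis count_list_0_iff not_less)
    moreover have "(\<forall>i. P p i (count_list xs i)) \<longleftrightarrow>
        (\<forall>i. k < i \<and> i < p \<longrightarrow> count_list xs i = 0) \<and> k + 1 \<le> count_list xs p"
      by (auto simp: P_def)
    ultimately show ?thesis by auto
  qed
  have le: "p \<le> N" if "xs \<in> partitions n" "p \<in> set xs" for xs p
    using that n member_le_sum_list[of p xs] unfolding partitions_def by auto
  define E where "E xs \<longleftrightarrow>
    (\<exists>p\<in>set xs. k < p \<and> (\<forall>x\<in>set xs. k < x \<longrightarrow> p \<le> x) \<and> k + 1 \<le> count_list xs p)" for xs
  have E_iff: "E xs \<longleftrightarrow> (\<exists>p\<in>{k<..N}. \<forall>i. P p i (count_list xs i))" if "xs \<in> partitions n" for xs
    unfolding E_def P_iff using le[OF that] by (meson greaterThanAtMost_iff)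
  have "z \<in> {(xs, S) \<in> overpartitions n. E xs} \<longleftrightarrow> z \<in> (\<Union>p\<in>{k<..N}. A p)" for z
  proof (cases z)
    case (Pair xs S)
    then show ?thesis
      by (cases "xs \<in> partitions n") (simp_all add: A_def overpartitions_def E_iff)
  qed
  then have "{(xs, S) \<in> overpartitions n. E xs} = (\<Union>p\<in>{k<..N}. A p)" by blast
  then have "int (Mbar k n) = int (card (\<Union>p\<in>{k<..N}. A p))"
    unfolding Mbar_def E_def[symmetric] by simp
  also have "\<dots> = (\<Sum>p\<in>{k<..N}. int (card (A p)))"
  proof (subst card_UN_disjoint)
    show "\<forall>p\<in>{k<..N}. finite (A p)"
      unfolding A_def using finite_overpartitions by (auto intro: finite_subset)
    show "\<forall>p\<in>{k<..N}. \<forall>p'\<in>{k<..N}. p \<noteq> p' \<longrightarrow> A p \<inter> A p' = {}"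
    proof (intro ballI impI)
      fix p p' assume "p \<in> {k<..N}" "p' \<in> {k<..N}" "p \<noteq> p'"
      then have "p = p'" if "\<forall>i. P p i (count_list xs i)" "\<forall>i. P p' i (count_list xs i)" for xs
        using that unfolding P_iff by (meson greaterThanAtMost_iff order.antisym)
      with \<open>p \<noteq> p'\<close> show "A p \<inter> A p' = {}" unfolding A_def by blast
    qed
  qed simp_all
  also have "\<dots> = (\<Sum>p\<in>{k<..N}. fps_nth ((\<Prod>i=1..k. over i) *
      (2 * fps_X ^ (p * (k + 1)) * geo p * over_tail N p)) n)"
  proof (intro sum.cong refl)
    fix p assume p: "p \<in> {k<..N}"
    let ?f = "\<lambda>i. Abs_fps (\<lambda>m. if P p i m then if m = 0 then 1 else 2 else 0) oo fps_X ^ i :: int fps"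
    have "int (card (A p)) = fps_nth (\<Prod>i=1..N. ?f i) n"
      unfolding A_def using p by (intro card_overpartitions_gf n) (auto simp: P_def)
    also have "{1..N} = {1..k} \<union> ({k<..<p} \<union> insert p {p<..N})"
      using p by auto
    also have "(\<Prod>i\<in>\<dots>. ?f i) = (\<Prod>i=1..k. ?f i) * ((\<Prod>i\<in>{k<..<p}. ?f i) * (?f p * (\<Prod>i\<in>{p<..N}. ?f i)))"
    proof -
      have "{1..k} \<inter> ({k<..<p} \<union> insert p {p<..N}) = {}" "{k<..<p} \<inter> insert p {p<..N} = {}"
        using p by auto
      then show ?thesis by (simp only: prod.union_disjoint prod.insert finite_atLeastAtMost
            finite_greaterThanLessThan finite_greaterThanAtMost finite_Un finite_insert)
          simp
    qed
    also have "(\<Prod>i=1..k. ?f i) = (\<Prod>i=1..k. over i)"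
      using p by (intro prod.cong refl) (simp add: P_def over_eq_Abs_fps)
    also have "(\<Prod>i\<in>{p<..N}. ?f i) = over_tail N p"
      unfolding over_tail_def using p by (intro prod.cong refl) (simp add: P_def over_eq_Abs_fps)
    also have "?f p = 2 * fps_X ^ (p * (k + 1)) * geo p"
      using p by (simp add: P_def more_than_eq[simplified])
    also have "(\<Prod>i\<in>{k<..<p}. ?f i) = 1"
    proof (intro prod.neutral ballI)
      fix i assume "i \<in> {k<..<p}"
      then have "Abs_fps (\<lambda>m. if P p i m then if m = 0 then 1 else 2 else 0) = (1 :: int fps)"
        by (auto simp: fps_eq_iff P_def)
      then show "?f i = 1" by simp
    qed
    finally show "int (card (A p)) = fps_nth ((\<Prod>i=1..k. over i) *
      (2 * fps_X ^ (p * (k + 1)) * geo p * over_tail N p)) n" by simp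
  qed
  also have "\<dots> = fps_nth (Mbar_gf N k) n"
    by (simp only: Mbar_gf_def sum_distrib_left fps_sum_nth)
  finally show "fps_nth (Abs_fps (\<lambda>n. int (Mbar k n))) n = fps_nth (Mbar_gf N k) n" by simp
qed

section \<open>From the truncated theta identity to pod\<close>

text \<open>The factors \<open>1 + q ^ i\<close> with odd \<open>i\<close> are common to both sides. On the left, the numerators of
  \<open>over (4 * i)\<close> supply exactly the factors \<open>1 + q ^ i\<close> that are missing for \<open>4 dvd i\<close>, so \<open>1 + q ^ i\<close>
  remains for every even \<open>i \<le> 4 * M\<close>, and it equals \<open>(1 - q ^ (2 * i)) / (1 - q ^ i)\<close>. Here \<open>2 * i\<close> runs
  through the \<open>4 * j\<close> with \<open>j \<le> 2 * M\<close>, and the denominators of \<open>over (4 * j)\<close> cancel those with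
  \<open>j \<le> M\<close>. The surviving factors on the right differ from \<open>1\<close> only in degrees above \<open>4 * M\<close>.\<close>

lemma pod_product:
  "(\<Prod>i=1..4*M. if 4 dvd i then 1 else 1 + fps_X ^ i) * (\<Prod>i=1..M. over (4 * i))
    = (\<Prod>i=1..4*M. if odd i then 1 + fps_X ^ i else geo i) * (\<Prod>i\<in>{M<..2*M}. 1 - fps_X ^ (4 * i))"
proof (induction M)
  case (Suc M)
  let ?q = "\<lambda>i. if 4 dvd i then 1 else 1 + fps_X ^ i :: int fps"
  let ?p = "\<lambda>i. if odd i then 1 + fps_X ^ i else geo i"
  let ?d = "\<lambda>i. 1 - fps_X ^ (4 * i) :: int fps"
  let ?x = "\<lambda>i. fps_X ^ i :: int fps"
  define a b c d where "a = 4 * M + 1" and "b = 4 * M + 2" and "c = 4 * M + 3" and "d = 4 * M + 4"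
  have ivl: "{1..4 * Suc M} = {1..4*M} \<union> {a, b, c, d}"
    by (auto simp: a_def b_def c_def d_def)
  have four: "(\<Prod>i=1..4 * Suc M. f i) = (\<Prod>i=1..4*M. f i) * (f a * f b * f c * f d)"
    for f :: "nat \<Rightarrow> int fps"
    unfolding ivl by (subst prod.union_disjoint) (auto simp: a_def b_def c_def d_def mult.assoc)
  have q: "?q a * ?q b * ?q c * ?q d = (1 + ?x a) * (1 + ?x b) * (1 + ?x c)"
  proof -
    have "\<not> 4 dvd a" "\<not> 4 dvd b" "\<not> 4 dvd c" "4 dvd d"
      unfolding a_def b_def c_def d_def by presburger+
    then show ?thesis by simp
  qed
  have p: "?p a * ?p b * ?p c * ?p d = (1 + ?x a) * geo b * (1 + ?x c) * geo d"
    by (simp add: a_def b_def c_def d_def)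
  have o: "(\<Prod>i=1..Suc M. over (4 * i)) = (\<Prod>i=1..M. over (4 * i)) * ((1 + ?x d) * geo d)"
    by (simp add: over_def d_def add.commute)
  have D: "(\<Prod>i\<in>{Suc M<..2 * Suc M}. ?d i) * ?d (Suc M)
    = (\<Prod>i\<in>{M<..2*M}. ?d i) * ((1 - ?x b) * (1 + ?x b)) * ((1 - ?x d) * (1 + ?x d))"
  proof -
    have bb: "4 * (2 * M + 1) = b + b" and dd: "4 * (2 * M + 2) = d + d"
      by (simp_all add: b_def d_def)
    have "{M<..2 * Suc M} = insert (Suc M) {Suc M<..2 * Suc M}" by auto
    then have "(\<Prod>i\<in>{Suc M<..2 * Suc M}. ?d i) * ?d (Suc M) = (\<Prod>i\<in>{M<..2 * Suc M}. ?d i)"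
      by (simp add: mult.commute)
    also have "{M<..2 * Suc M} = {M<..2*M} \<union> {2 * M + 1, 2 * M + 2}" by auto
    also have "(\<Prod>i\<in>\<dots>. ?d i) = (\<Prod>i\<in>{M<..2*M}. ?d i) * (?d (2 * M + 1) * ?d (2 * M + 2))"
      by (subst prod.union_disjoint) auto
    also have "?d (2 * M + 1) = (1 - ?x b) * (1 + ?x b)"
      unfolding bb power_add by (simp add: algebra_simps)
    also have "?d (2 * M + 2) = (1 - ?x d) * (1 + ?x d)"
      unfolding dd power_add by (simp add: algebra_simps)
    finally show ?thesis by (simp only: mult.assoc)
  qed
  have gb: "(1 - ?x b) * geo b = 1" and gd: "(1 - ?x d) * geo d = 1"
    by (rule geo_inverse, simp add: b_def d_def)+
  have "(\<Prod>i\<in>{Suc M<..2 * Suc M}. ?d i) = (\<Prod>i\<in>{Suc M<..2 * Suc M}. ?d i) * ((1 - ?x d) * geo d)"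
    by (simp add: gd)
  also have "\<dots> = ((\<Prod>i\<in>{Suc M<..2 * Suc M}. ?d i) * ?d (Suc M)) * geo d"
    by (simp add: d_def mult.assoc add.commute)
  also have "\<dots> = (\<Prod>i\<in>{M<..2*M}. ?d i) * ((1 - ?x b) * (1 + ?x b)) * (1 + ?x d) * ((1 - ?x d) * geo d)"
    unfolding D by (simp only: ac_simps)
  finally have D': "(\<Prod>i\<in>{Suc M<..2 * Suc M}. ?d i)
    = (\<Prod>i\<in>{M<..2*M}. ?d i) * ((1 - ?x b) * (1 + ?x b)) * (1 + ?x d)"
    by (simp only: gd mult_1_right)
  have "(\<Prod>i=1..4 * Suc M. ?p i) * (\<Prod>i\<in>{Suc M<..2 * Suc M}. ?d i)
    = ((\<Prod>i=1..4*M. ?p i) * (\<Prod>i\<in>{M<..2*M}. ?d i)) * ((1 + ?x a) * (1 + ?x b) * (1 + ?x c))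
      * ((1 - ?x b) * geo b) * ((1 + ?x d) * geo d)"
    unfolding four p D' by (simp only: ac_simps)
  also have "\<dots> = (\<Prod>i=1..4 * Suc M. ?q i) * (\<Prod>i=1..Suc M. over (4 * i))"
    unfolding four q o gb Suc.IH[symmetric] mult_1_right by (simp only: ac_simps)
  finally show ?case ..
qed simp

lemma pod_product_agree:
  "agree (4 * M) (\<Prod>i=1..4*M. if odd i then 1 + fps_X ^ i else geo i)
    ((\<Prod>i=1..4*M. if 4 dvd i then 1 else 1 + fps_X ^ i) * ((\<Prod>i=1..M. over i) oo fps_X ^ 4))"
proof -
  have "agree (4 * M) (\<Prod>i\<in>{M<..2*M}. 1 - fps_X ^ (4 * i)) 1"
  proof (rule agree_prod_1)
    fix i assume "i \<in> {M<..2*M}"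
    then show "agree (4 * M) (1 - fps_X ^ (4 * i)) 1"
      using agree_X_power[of "4 * M" "4 * i" 1 1] by simp
  qed
  then have "agree (4 * M) (f * 1) (f * (\<Prod>i\<in>{M<..2*M}. 1 - fps_X ^ (4 * i)))" for f
    by (rule agree_mult[OF agree_refl agree_sym])
  moreover have "(\<Prod>i=1..M. over i) oo fps_X ^ 4 = (\<Prod>i=1..M. over (4 * i))"
    by (simp add: fps_compose_prod_distrib over_compose)
  ultimately show ?thesis by (simp only: pod_product mult_1_right)
qed

lemma pod_theta_eq:
  "Abs_fps (\<lambda>n. int (pod (int n))) * (theta_gf k oo fps_X ^ 4)
    = Abs_fps (\<lambda>n. int (Q0 n)) * ((1 + (- 1) ^ k * Abs_fps (\<lambda>n. int (Mbar k n))) oo fps_X ^ 4)"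
  (is "?P * ?T = ?Q * ?R")
proof -
  have "fps_nth (?P * ?T) n = fps_nth (?Q * ?R) n" for n
  proof -
    \<comment> \<open>Large enough for degree \<open>n\<close>, and for the truncated theta identity, which needs \<open>k \<le> M\<close>.\<close>
    define M where "M = n + k"
    let ?O = "\<Prod>i=1..M. over i"
    have "agree (4 * M) (?P * ?T) ((?Q * (?O oo fps_X ^ 4)) * ?T)"
    proof (intro agree_mult[OF _ agree_refl])
      note pod_agree
      also note pod_product_agree
      also have "agree (4 * M) ((\<Prod>i=1..4*M. if 4 dvd i then 1 else 1 + fps_X ^ i) * (?O oo fps_X ^ 4))
          (?Q * (?O oo fps_X ^ 4))"
        by (rule agree_mult[OF agree_sym[OF Q0_agree] agree_refl])
      finally show "agree (4 * M) ?P (?Q * (?O oo fps_X ^ 4))" .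
    qed
    also have "(?Q * (?O oo fps_X ^ 4)) * ?T = ?Q * ((?O * theta_gf k) oo fps_X ^ 4)"
      by (simp add: fps_compose_mult_distrib mult.assoc)
    also have "agree (4 * M) \<dots> (?Q * ((1 + (- 1) ^ k * Mbar_gf M k) oo fps_X ^ 4))"
      by (intro agree_mult agree_refl agree_compose_X_power truncated_theta) (auto simp: M_def)
    also have "agree (4 * M) \<dots> (?Q * ?R)"
    proof -
      have "agree M (Mbar_gf M k) (Abs_fps (\<lambda>n. int (Mbar k n)))"
        by (intro agree_sym[OF Mbar_agree]) (simp add: M_def)
      then have "agree M (1 + (- 1) ^ k * Mbar_gf M k) (1 + (- 1) ^ k * Abs_fps (\<lambda>n. int (Mbar k n)))"
        by (intro agree_add agree_mult agree_refl)
      then show ?thesis by (intro agree_mult agree_refl agree_compose_X_power) auto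
    qed
    finally show ?thesis by (simp add: agree_def M_def)
  qed
  then show ?thesis by (simp add: fps_eq_iff)
qed

theorem theorem4p1:
  fixes n k :: nat
  assumes "n > 0" and "k > 0"
  shows "(-1) ^ k * (int (pod (int n))
           + 2 * (\<Sum>j = 1..k. (-1) ^ j * int (pod (int n - 4 * (int j)\<^sup>2)))
           - int (Q0 n))
         = int (\<Sum>j = 0..n div 4. Q0 (n - 4 * j) * Mbar k j)"
proof -
  let ?P = "Abs_fps (\<lambda>n. int (pod (int n)))" and ?Q = "Abs_fps (\<lambda>n. int (Q0 n))"
    and ?M = "Abs_fps (\<lambda>n. int (Mbar k n))"
  let ?e = "(- 1) ^ k :: int"
  have X: "fps_nth (fps_X ^ 4 :: int fps) 0 = 0" by simp
  have theta: "theta_gf k oo fps_X ^ 4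
      = 1 + fps_const 2 * (\<Sum>j=1..k. fps_const ((- 1) ^ j) * fps_X ^ (4 * j\<^sup>2))"
  proof -
    have "theta_gf k = 1 + fps_const 2 * (\<Sum>j=1..k. fps_const ((- 1) ^ j) * fps_X ^ (j\<^sup>2))"
      unfolding theta_gf_def by (simp add: numeral_fps_const flip: fps_const_power fps_const_neg)
    then show ?thesis
      by (simp add: fps_compose_add_distrib fps_compose_mult_distrib fps_compose_sum_distrib
          flip: fps_compose_power power_mult)
  qed
  have shift: "fps_nth (?P * fps_X ^ (4 * j\<^sup>2)) n = int (pod (int n - 4 * (int j)\<^sup>2))" for j
  proof (cases "4 * j\<^sup>2 \<le> n")
    case True
    then have "int n - 4 * (int j)\<^sup>2 = int (n - 4 * j\<^sup>2)" by (simp add: of_nat_diff)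
    with True show ?thesis by (simp add: fps_X_power_mult_right_nth)
  next
    case False
    then have "int n < int (4 * j\<^sup>2)" by (simp only: of_nat_less_iff not_le)
    then have "pod (int n - 4 * (int j)\<^sup>2) = 0" by (simp add: pod_def)
    moreover have "fps_nth (?P * fps_X ^ (4 * j\<^sup>2)) n = 0"
      using False by (simp only: fps_X_power_mult_right_nth not_le if_True)
    ultimately show ?thesis by simp
  qed
  have "fps_nth (?P * (theta_gf k oo fps_X ^ 4)) n = int (pod (int n))
      + 2 * (\<Sum>j = 1..k. (-1) ^ j * int (pod (int n - 4 * (int j)\<^sup>2)))"
  proof -
    have "?P * (theta_gf k oo fps_X ^ 4)
        = ?P + fps_const 2 * (\<Sum>j=1..k. fps_const ((- 1) ^ j) * (?P * fps_X ^ (4 * j\<^sup>2)))"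
      unfolding theta by (simp add: distrib_left sum_distrib_left ac_simps)
    then show ?thesis by (simp add: fps_sum_nth shift)
  qed
  moreover have "fps_nth (?Q * ((1 + (- 1) ^ k * ?M) oo fps_X ^ 4)) n
      = int (Q0 n) + ?e * int (\<Sum>j = 0..n div 4. Q0 (n - 4 * j) * Mbar k j)"
  proof -
    have "(- 1) ^ k = fps_const ?e"
      by (simp flip: fps_const_power fps_const_neg)
    then have "(1 + (- 1) ^ k * ?M) oo fps_X ^ 4 = 1 + fps_const ?e * (?M oo fps_X ^ 4)"
      by (simp only: fps_compose_add_distrib fps_compose_1 fps_compose_mult_distrib[OF X] fps_const_compose)
    then have "?Q * ((1 + (- 1) ^ k * ?M) oo fps_X ^ 4)
        = ?Q + fps_const ?e * (?Q * (?M oo fps_X ^ 4))"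
      by (simp add: distrib_left ac_simps)
    moreover have "{m. m \<le> n \<and> 4 * m \<le> n} = {0..n div 4}" by auto
    ultimately show ?thesis by (simp add: fps_nth_mult_compose_X_power)
  qed
  ultimately have "int (pod (int n)) + 2 * (\<Sum>j = 1..k. (-1) ^ j * int (pod (int n - 4 * (int j)\<^sup>2)))
      = int (Q0 n) + ?e * int (\<Sum>j = 0..n div 4. Q0 (n - 4 * j) * Mbar k j)"
    by (simp only: pod_theta_eq)
  moreover have "?e * ?e = 1" by (simp flip: power_mult_distrib)
  ultimately show ?thesis
    by (simp only: add_diff_cancel_left' mult.assoc[symmetric] mult_1)
qed

end
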